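(* Let $T\ge 1$ be an integer, $\alpha\in(0,1)$, and let $\{\mathcal{C}_t\}_{t=1,\dots,T}$ be the sequence of certificates returned by the sim-to-real betting procedure (described in the context) run on the i.i.d. real observations $y_1,\dots,y_T\in[0,1]$ with mean $\mu^*$, with an arbitrary simulator bank $\{(\mu_k,\sigma_k^2)\}_{k=1}^K$. Then $$\mathbb{P}\big(\mu^*\in\mathcal{C}_t\ \text{ for all } t\in\{1,\dots,T\}\big)\ \ge\ 1-\alpha .$$
   Context: Real data: $P$ is a probability distribution on a measurable space $\mathcal{X}$, $\psi:\mathcal{X}\to[0,1]$ is measurable, $x_1,x_2,\dots$ are i.i.d. from $P$, $y_t=\psi(x_t)$, and $\mu^*=\mathbb{E}[y_t]$. Candidate means are $\mu\in\mathcal{M}=[0,1]$. Simulator bank: $K\ge1$ fixed (deterministic) pairs $(\mu_k,\sigma_k^2)$, $k=1,\dots,K$, with $\mu_k\in[0,1]$ and $\sigma_k^2>0$; no relation to the law of $y_t$ is assumed. Sim-to-real betting procedure, with parameters $\eta>0$, $\kappa\in(0,1]$, $\delta\in(0,1)$, $\alpha\in(0,1)$, horizon $T$. Initialize $L_0^k=0$ for all $k$ and $M_0(\mu)=1$ for all $\mu\in\mathcal{M}$. For $t=1,\dots,T$: (1) before seeing $y_t$, compute the trust weights and aggregated moments $$\pi_t^k=\frac{\exp(\eta L_{t-1}^k)}{\sum_{j=1}^K\exp(\eta L_{t-1}^j)},\qquad m_t=\sum_{k=1}^K\pi_t^k\mu_k,\qquad v_t=\sum_{k=1}^K\pi_t^k\sigma_k^2;$$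 (2) for every $\mu\in\mathcal{M}$ choose the stake $\lambda_t(\mu)=\mathrm{clip}_\delta\Big\{\frac{\kappa(m_t-\mu)}{v_t+(m_t-\mu)^2}\Big\}$, where $\mathrm{clip}_\delta$ truncates a real number to the interval $\big[-\tfrac{1-\delta}{1-\mu},\tfrac{1-\delta}{\mu}\big]$ (an endpoint with zero denominator is read as $-\infty$, respectively $+\infty$, i.e. no truncation on that side); (3) observe $y_t$ and update the wealth $M_t(\mu)=M_{t-1}(\mu)\,[1+\lambda_t(\mu)(y_t-\mu)]$ for all $\mu\in\mathcal{M}$; (4) update the scores $L_t^k=L_{t-1}^k+\log\mathcal{N}(y_t;\mu_k,\sigma_k^2)$ for all $k$, where $\mathcal{N}(y;m,v)=(2\pi v)^{-1/2}\exp(-(y-m)^2/(2v))$; (5) output the certificate $\mathcal{C}_t=\mathrm{hull}\big(\{\mu\in\mathcal{M}:\ \max_{1\le s\le t}M_s(\mu)<1/\alpha\}\big)$, where $\mathrm{hull}(A)=[\inf A,\sup A]$ for nonempty $A$ and $\mathrm{hull}(\emptyset)=\emptyset$. *)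

theory Defs
  imports "HOL-Probability.Probability"
begin

(* Conventions: y t is the observation of round t >= 1 (y 0 is never used); m k and s k
   are the mean and the VARIANCE of simulator k, for k in {1..K}. *)

(* normal_density is parametrised by the standard deviation, hence sqrt (s k). *)
primrec score :: "(nat \<Rightarrow> real) \<Rightarrow> (nat \<Rightarrow> real) \<Rightarrow> (nat \<Rightarrow> real) \<Rightarrow> nat \<Rightarrow> nat \<Rightarrow> real" where
  "score m s y 0 k = 0"
| "score m s y (Suc t) k = score m s y t k + ln (normal_density (m k) (sqrt (s k)) (y (Suc t)))"

(* The index t is the round in which the quantity is used, so that only the observations
   y 1, ..., y (t - 1) enter. *)
definition trust_weight ::
  "real \<Rightarrow> nat \<Rightarrow> (nat \<Rightarrow> real) \<Rightarrow> (nat \<Rightarrow> real) \<Rightarrow> (nat \<Rightarrow> real) \<Rightarrow> nat \<Rightarrow> nat \<Rightarrow> real" where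
  "trust_weight \<eta> K m s y t k =
     exp (\<eta> * score m s y (t - 1) k) / (\<Sum>j = 1..K. exp (\<eta> * score m s y (t - 1) j))"

definition agg_mean ::
  "real \<Rightarrow> nat \<Rightarrow> (nat \<Rightarrow> real) \<Rightarrow> (nat \<Rightarrow> real) \<Rightarrow> (nat \<Rightarrow> real) \<Rightarrow> nat \<Rightarrow> real" where
  "agg_mean \<eta> K m s y t = (\<Sum>k = 1..K. trust_weight \<eta> K m s y t k * m k)"

definition agg_var ::
  "real \<Rightarrow> nat \<Rightarrow> (nat \<Rightarrow> real) \<Rightarrow> (nat \<Rightarrow> real) \<Rightarrow> (nat \<Rightarrow> real) \<Rightarrow> nat \<Rightarrow> real" where
  "agg_var \<eta> K m s y t = (\<Sum>k = 1..K. trust_weight \<eta> K m s y t k * s k)"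

(* Truncation to [-(1-\<delta>)/(1-\<mu>), (1-\<delta>)/\<mu>]; an endpoint with zero denominator
   stands for an infinite one, so there is no truncation on that side. *)
definition clip_stake :: "real \<Rightarrow> real \<Rightarrow> real \<Rightarrow> real" where
  "clip_stake \<delta> \<mu> z =
     (let z' = (if \<mu> = 1 then z else max (- ((1 - \<delta>) / (1 - \<mu>))) z)
      in if \<mu> = 0 then z' else min ((1 - \<delta>) / \<mu>) z')"

definition stake ::
  "real \<Rightarrow> real \<Rightarrow> real \<Rightarrow> nat \<Rightarrow> (nat \<Rightarrow> real) \<Rightarrow> (nat \<Rightarrow> real) \<Rightarrow> (nat \<Rightarrow> real) \<Rightarrow> nat \<Rightarrow> real \<Rightarrow> real" where
  "stake \<eta> \<kappa> \<delta> K m s y t \<mu> =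
     clip_stake \<delta> \<mu>
       (\<kappa> * (agg_mean \<eta> K m s y t - \<mu>)
        / (agg_var \<eta> K m s y t + (agg_mean \<eta> K m s y t - \<mu>)\<^sup>2))"

primrec wealth ::
  "real \<Rightarrow> real \<Rightarrow> real \<Rightarrow> nat \<Rightarrow> (nat \<Rightarrow> real) \<Rightarrow> (nat \<Rightarrow> real) \<Rightarrow> (nat \<Rightarrow> real) \<Rightarrow> nat \<Rightarrow> real \<Rightarrow> real" where
  "wealth \<eta> \<kappa> \<delta> K m s y 0 \<mu> = 1"
| "wealth \<eta> \<kappa> \<delta> K m s y (Suc t) \<mu> =
     wealth \<eta> \<kappa> \<delta> K m s y t \<mu> * (1 + stake \<eta> \<kappa> \<delta> K m s y (Suc t) \<mu> * (y (Suc t) - \<mu>))"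

(* Only meaningful for bounded A, as real Inf and Sup are unspecified otherwise. *)
definition interval_hull :: "real set \<Rightarrow> real set" where
  "interval_hull A = (if A = {} then {} else {Inf A..Sup A})"

definition certificate ::
  "real \<Rightarrow> real \<Rightarrow> real \<Rightarrow> real \<Rightarrow> nat \<Rightarrow> (nat \<Rightarrow> real) \<Rightarrow> (nat \<Rightarrow> real) \<Rightarrow> (nat \<Rightarrow> real) \<Rightarrow> nat \<Rightarrow> real set" where
  "certificate \<eta> \<kappa> \<delta> \<alpha> K m s y t =
     interval_hull {\<mu> \<in> {0..1}. (MAX r\<in>{1..t}. wealth \<eta> \<kappa> \<delta> K m s y r \<mu>) < 1 / \<alpha>}"

end

(* For the true mean, the wealth is a nonnegative martingale started at 1, because the stake of
   each round only depends on earlier, independent observations. Ville's inequality bounds the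
   probability that it ever reaches 1/\<alpha> by \<alpha>, and as long as it does not, the true
   mean lies in the certificate. The hull ranges over uncountably many candidates, but the wealth
   is continuous in the candidate mean, so rational candidates suffice and the coverage event is
   measurable. *)

theory Submission
  imports Defs
begin

section \<open>Ville's inequality for betting wealth\<close>

text \<open>Freezing the wealth at the level \<open>c\<close> when it first gets there yields a
  process whose expectation cannot grow, and Markov's inequality at time \<open>T\<close> then
  controls all rounds at once. Note the index shift: \<open>h t\<close> is the bet on observation
  \<open>Suc t\<close>, so it may depend on the first \<open>t\<close> coordinates only.\<close>

lemma (in prob_space) ville_betting:
  fixes Y :: "nat \<Rightarrow> 'a \<Rightarrow> real" and W h :: "nat \<Rightarrow> (nat \<Rightarrow> real) \<Rightarrow> real"
  assumes indep: "indep_vars (\<lambda>_. borel) Y {1..}"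
    and Y01: "\<And>t \<omega>. t \<ge> 1 \<Longrightarrow> \<omega> \<in> space M \<Longrightarrow> Y t \<omega> \<in> {0..1}"
    and mean: "\<And>t. t \<ge> 1 \<Longrightarrow> expectation (Y t) = \<mu>"
    and h_meas: "\<And>t. h t \<in> borel_measurable (PiM {1..t} (\<lambda>_. borel))"
    and h_past: "\<And>t f. h t (restrict f {1..t}) = h t f"
    and h_bound: "\<And>t f. \<bar>h t f\<bar> \<le> C"
    and W_0: "\<And>f. W 0 f = 1"
    and W_Suc: "\<And>t f. W (Suc t) f = W t f * (1 + h t f * (f (Suc t) - \<mu>))"
    and W_nonneg: "\<And>t \<omega>. \<omega> \<in> space M \<Longrightarrow> 0 \<le> W t (\<lambda>i. Y i \<omega>)"
    and c: "c > 0"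
  shows "prob {\<omega> \<in> space M. \<exists>r\<le>T. c \<le> W r (\<lambda>i. Y i \<omega>)} \<le> 1 / c"
proof -
  have Y_meas [measurable]: "Y t \<in> borel_measurable M" if "t \<ge> 1" for t
    using indep that by (auto simp: indep_vars_def)
  have "\<mu> = expectation (Y 1)"
    using mean[of 1] by simp
  moreover have "integrable M (Y 1)"
    using Y01[of 1] by (intro integrable_const_bound[where B = 1]) auto
  ultimately have \<mu>: "\<mu> \<in> {0..1}"
    using Y01[of 1] by (auto intro!: integral_ge_const integral_le_const)
  have "0 \<le> \<bar>h 0 (\<lambda>_. 0)\<bar>"
    by simp
  then have C: "0 \<le> C"
    using h_bound order_trans by blast

  \<comment> \<open>A functional of the first \<open>r\<close> coordinates stays measurable on a
    longer block, because it factors through the restriction to \<open>{1..r}\<close>.\<close>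
  have h_meas': "h r \<in> borel_measurable (PiM {1..t} (\<lambda>_. borel))" if "r \<le> t" for r t
  proof -
    have "(\<lambda>f. h r (restrict f {1..r})) \<in> borel_measurable (PiM {1..t} (\<lambda>_. borel))"
      using that by (intro measurable_compose[OF measurable_restrict_subset h_meas]) auto
    then show ?thesis
      by (simp only: h_past)
  qed
  have W_meas: "W r \<in> borel_measurable (PiM {1..t} (\<lambda>_. borel))" if "r \<le> t" for r t
    using that
  proof (induction r)
    case 0
    then show ?case by (simp add: W_0 [abs_def])
  next
    case (Suc r)
    have [measurable]: "W r \<in> borel_measurable (PiM {1..t} (\<lambda>_. borel))"
      "h r \<in> borel_measurable (PiM {1..t} (\<lambda>_. borel))"
      "(\<lambda>f. f (Suc r)) \<in> borel_measurable (PiM {1..t} (\<lambda>_. borel))"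
      using Suc h_meas'[of r t] measurable_component_singleton[of "Suc r" "{1..t}" "\<lambda>_. borel"]
      by auto
    show ?case
      unfolding W_Suc by measurable
  qed
  have W_past: "W r (restrict f {1..t}) = W r f" if "r \<le> t" for r t f
    using that
  proof (induction r)
    case (Suc r)
    have "h r (restrict f {1..t}) = h r (restrict (restrict f {1..t}) {1..r})"
      by (simp only: h_past)
    also have "restrict (restrict f {1..t}) {1..r} = restrict f {1..r}"
      using Suc.prems by (auto simp: restrict_def)
    finally have "h r (restrict f {1..t}) = h r f"
      by (simp only: h_past)
    then show ?case
      using Suc by (simp only: W_Suc) simp
  qed (simp add: W_0)

  define past where "past t \<omega> = restrict (\<lambda>i. Y i \<omega>) {1..t}" for t \<omega>
  have past_meas [measurable]: "past t \<in> measurable M (PiM {1..t} (\<lambda>_. borel))" for t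
    unfolding past_def by (intro measurable_restrict) simp
  define V where "V t \<omega> = W t (\<lambda>i. Y i \<omega>)" for t \<omega>
  have V_meas [measurable]: "V t \<in> borel_measurable M" for t
  proof -
    have "(\<lambda>\<omega>. W t (past t \<omega>)) \<in> borel_measurable M"
      by (rule measurable_compose[OF past_meas W_meas]) simp
    then show ?thesis
      by (simp only: V_def [abs_def] past_def W_past[OF order_refl])
  qed
  have dev: "\<bar>Y (Suc t) \<omega> - \<mu>\<bar> \<le> 1" if "\<omega> \<in> space M" for t \<omega>
    using Y01[OF _ that, of "Suc t"] \<mu> by auto
  \<comment> \<open>Each betting factor is at most \<open>1 + C\<close> in absolute value, so the
    wealth at a fixed time is bounded; every integrability claim below rests on this.\<close>
  have V_bound: "\<bar>V t \<omega>\<bar> \<le> (1 + C) ^ t" if "\<omega> \<in> space M" for t \<omega>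
  proof (induction t)
    case (Suc t)
    have "\<bar>h t (\<lambda>i. Y i \<omega>) * (Y (Suc t) \<omega> - \<mu>)\<bar> \<le> C * 1"
      unfolding abs_mult using h_bound dev[OF that] C by (intro mult_mono) auto
    then have "\<bar>1 + h t (\<lambda>i. Y i \<omega>) * (Y (Suc t) \<omega> - \<mu>)\<bar> \<le> 1 + C"
      by linarith
    then have "\<bar>V t \<omega>\<bar> * \<bar>1 + h t (\<lambda>i. Y i \<omega>) * (Y (Suc t) \<omega> - \<mu>)\<bar> \<le> (1 + C) ^ t * (1 + C)"
      using Suc C by (intro mult_mono) auto
    then show ?case
      by (simp add: V_def W_Suc abs_mult mult.commute)
  qed (simp add: V_def W_0)

  define Z where "Z t \<omega> = (if \<forall>r\<le>t. V r \<omega> < c then V t \<omega> else c)" for t \<omega>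
  have Z_meas [measurable]: "Z t \<in> borel_measurable M" for t
    unfolding Z_def [abs_def] by measurable
  have Z_int: "integrable M (Z t)" for t
  proof (rule integrable_const_bound[where B = "(1 + C) ^ t + c"])
    show "AE \<omega> in M. norm (Z t \<omega>) \<le> (1 + C) ^ t + c"
    proof (rule AE_I2)
      fix \<omega> assume "\<omega> \<in> space M"
      from V_bound[OF this, of t] c C show "norm (Z t \<omega>) \<le> (1 + C) ^ t + c"
        by (auto simp: Z_def)
    qed
  qed simp
  define G where
    "G t f = (if \<forall>r\<le>t. W r f < c then W t f * h t f else 0)" for t and f :: "nat \<Rightarrow> real"
  have G_meas [measurable]: "G t \<in> borel_measurable (PiM {1..t} (\<lambda>_. borel))" for t
  proof -
    have [measurable]: "W r \<in> borel_measurable (PiM {1..t} (\<lambda>_. borel))" if "r \<in> {..t}" for r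
      using that W_meas by simp
    note h_meas [measurable]
    have "G t = (\<lambda>f. if \<forall>r\<in>{..t}. W r f < c then W t f * h t f else 0)"
      by (auto simp: G_def)
    also have "\<dots> \<in> borel_measurable (PiM {1..t} (\<lambda>_. borel))"
      by measurable
    finally show ?thesis .
  qed
  have G_past: "G t (past t \<omega>) = G t (\<lambda>i. Y i \<omega>)" for t \<omega>
    by (auto simp: G_def past_def W_past h_past simp del: One_nat_def)
  have G_bound: "\<bar>G t (past t \<omega>)\<bar> \<le> (1 + C) ^ t * C" if "\<omega> \<in> space M" for t \<omega>
    using mult_mono[OF V_bound[OF that, of t] h_bound[of t "\<lambda>i. Y i \<omega>"]] C
    unfolding G_past by (auto simp: G_def abs_mult V_def)

  \<comment> \<open>Equality holds except in the round of the crossing, where the right side is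
    \<open>V (Suc t) \<omega>\<close>, at least \<open>c\<close>, and the left side is
    \<open>c\<close>.\<close>
  have Z_step: "Z (Suc t) \<omega> \<le> Z t \<omega> + G t (past t \<omega>) * (Y (Suc t) \<omega> - \<mu>)" for t \<omega>
    unfolding G_past by (auto simp: Z_def G_def V_def W_Suc le_Suc_eq algebra_simps not_less)
  have bet_fair: "integrable M (\<lambda>\<omega>. G t (past t \<omega>) * (Y (Suc t) \<omega> - \<mu>))"
      "expectation (\<lambda>\<omega>. G t (past t \<omega>) * (Y (Suc t) \<omega> - \<mu>)) = 0" for t
  proof -
    \<comment> \<open>The blocks \<open>{1..t}\<close> and \<open>{Suc t}\<close> are disjoint, so
      the amount staked is independent of the centred next observation; the expectation of the
      product factors and its second factor is 0.\<close>
    have "indep_var (PiM {1..t} (\<lambda>_. borel)) (\<lambda>\<omega>. restrict (\<lambda>i. Y i \<omega>) {1..t})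
        (PiM {Suc t} (\<lambda>_. borel)) (\<lambda>\<omega>. restrict (\<lambda>i. Y i \<omega>) {Suc t})"
      by (rule indep_var_restrict[OF indep]) auto
    from indep_var_compose[OF this G_meas, of "\<lambda>f. f (Suc t) - \<mu>" borel]
    have ind: "indep_var borel (\<lambda>\<omega>. G t (past t \<omega>)) borel (\<lambda>\<omega>. Y (Suc t) \<omega> - \<mu>)"
      by (simp add: comp_def past_def [abs_def])
    have int1: "integrable M (\<lambda>\<omega>. G t (past t \<omega>))"
      using G_bound by (intro integrable_const_bound[where B = "(1 + C) ^ t * C"]) auto
    have intY: "integrable M (Y (Suc t))"
      using Y01[of "Suc t"] by (intro integrable_const_bound[where B = 1]) auto
    then have int2: "integrable M (\<lambda>\<omega>. Y (Suc t) \<omega> - \<mu>)"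
      by simp
    show "integrable M (\<lambda>\<omega>. G t (past t \<omega>) * (Y (Suc t) \<omega> - \<mu>))"
      by (rule indep_var_integrable[OF ind int1 int2])
    show "expectation (\<lambda>\<omega>. G t (past t \<omega>) * (Y (Suc t) \<omega> - \<mu>)) = 0"
      using indep_var_lebesgue_integral[OF ind int1 int2] intY mean[of "Suc t"]
      by (simp add: prob_space)
  qed
  have Z_le: "expectation (Z t) \<le> 1" for t
  proof (induction t)
    case 0
    \<comment> \<open>The minimum covers levels \<open>c \<le> 1\<close>, which the initial wealth 1
      has already reached.\<close>
    have "Z 0 = (\<lambda>_. min 1 c)"
      by (auto simp: Z_def V_def W_0)
    then show ?case
      by (simp add: prob_space)
  next
    case (Suc t)
    have "expectation (Z (Suc t))
        \<le> expectation (\<lambda>\<omega>. Z t \<omega> + G t (past t \<omega>) * (Y (Suc t) \<omega> - \<mu>))"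
      using Z_step by (intro integral_mono Z_int Bochner_Integration.integrable_add bet_fair)
    also have "\<dots> = expectation (Z t)"
      using Z_int bet_fair by simp
    finally show ?case using Suc by simp
  qed
  \<comment> \<open>If the wealth reaches \<open>c\<close> by time \<open>T\<close>, then
    \<open>Z T\<close> equals \<open>c\<close>; Markov's inequality applies since \<open>Z T\<close>
    is nonnegative.\<close>
  have "prob {\<omega> \<in> space M. \<exists>r\<le>T. c \<le> V r \<omega>} \<le> prob {\<omega> \<in> space M. c \<le> Z T \<omega>}"
    by (intro finite_measure_mono) (auto simp: Z_def not_less)
  also have "\<dots> \<le> expectation (Z T) / c"
    using c W_nonneg
    by (intro integral_Markov_inequality_measure[OF Z_int, of "{}"])
       (auto simp: Z_def V_def)
  also have "\<dots> \<le> 1 / c"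
    using Z_le c by (intro divide_right_mono) auto
  finally show ?thesis
    unfolding V_def .
qed


section \<open>Hulls of relatively open sets\<close>

text \<open>The given point may be an endpoint of the unit interval. Since \<open>{0..1}\<close> is
  the closure of \<open>{0<..<1}\<close>, the open set also meets the interior, where rationals are
  dense.\<close>

lemma rational_in_relatively_open:
  fixes U :: "real set"
  assumes "open U" "x \<in> U" "x \<in> {0..1}"
  obtains q where "q \<in> \<rat>" "q \<in> U" "q \<in> {0..1}"
proof -
  have "U \<inter> closure {0<..<1} \<noteq> {}"
    using assms by auto
  then have "U \<inter> {0<..<1} \<noteq> {}"
    using open_Int_closure_eq_empty[OF assms(1)] by blast
  moreover have "open (U \<inter> {0<..<1})"
    using assms(1) by auto
  ultimately obtain a b where "a < b" "{a..<b} \<subseteq> U \<inter> {0<..<1}"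
    by (metis ex_in_conv open_right gt_ex)
  moreover obtain q where "q \<in> \<rat>" "a < q" "q < b"
    using Rats_dense_in_real[OF \<open>a < b\<close>] by blast
  ultimately have "q \<in> \<rat>" "q \<in> U \<inter> {0<..<1}"
    using atLeastLessThan_iff less_imp_le by blast+
  then show ?thesis
    using that by auto
qed

text \<open>A point lies in the hull iff members of \<open>A\<close> come arbitrarily close to it or
  pass it on either side. Relative openness of \<open>A\<close> lets rational members do so, which
  turns membership into a countable condition.\<close>

lemma interval_hull_rational_iff:
  assumes "open U" "A = {0..1} \<inter> U"
  shows "x \<in> interval_hull A \<longleftrightarrow>
    (\<forall>n. \<exists>q\<in>\<rat>. q \<in> A \<and> q < x + 1 / Suc n) \<and> (\<forall>n. \<exists>q\<in>\<rat>. q \<in> A \<and> x - 1 / Suc n < q)"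
    (is "_ \<longleftrightarrow> ?lower \<and> ?upper")
proof
  assume x: "x \<in> interval_hull A"
  then have "A \<noteq> {}" and Inf: "Inf A \<le> x" and Sup: "x \<le> Sup A"
    by (auto simp: interval_hull_def split: if_splits)
  have dense: "\<exists>q\<in>\<rat>. q \<in> A \<and> q \<in> I" if "open I" "a \<in> A" "a \<in> I" for a I
    using rational_in_relatively_open[of "U \<inter> I" a] that assms by blast
  show "?lower \<and> ?upper"
  proof (intro conjI allI)
    fix n
    have pos: "0 < 1 / real (Suc n)"
      by simp
    then have "Inf A < x + 1 / Suc n"
      using Inf by linarith
    then obtain a where "a \<in> A" "a < x + 1 / Suc n"
      using cInf_lessD[OF \<open>A \<noteq> {}\<close>] by blast
    then show "\<exists>q\<in>\<rat>. q \<in> A \<and> q < x + 1 / Suc n"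
      using dense[of "{..<x + 1 / Suc n}" a] by auto
    have "x - 1 / Suc n < Sup A"
      using Sup pos by linarith
    then obtain b where "b \<in> A" "x - 1 / Suc n < b"
      using less_cSupD[OF \<open>A \<noteq> {}\<close>] by blast
    then show "\<exists>q\<in>\<rat>. q \<in> A \<and> x - 1 / Suc n < q"
      using dense[of "{x - 1 / Suc n<..}" b] by auto
  qed
next
  assume *: "?lower \<and> ?upper"
  then have "A \<noteq> {}"
    by blast
  have bdd: "bdd_below A" "bdd_above A"
    using assms(2) by (auto intro: bdd_belowI[of _ 0] bdd_aboveI[of _ 1])
  have "Inf A \<le> x"
  proof (rule field_le_epsilon)
    fix e :: real assume "0 < e"
    then obtain n where "1 / Suc n < e"
      using nat_approx_posE by blast
    moreover obtain q where "q \<in> A" "q < x + 1 / Suc n"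
      using * by blast
    ultimately show "Inf A \<le> x + e"
      using cInf_lower[OF _ bdd(1), of q] by linarith
  qed
  moreover have "x \<le> Sup A"
  proof (rule field_le_epsilon)
    fix e :: real assume "0 < e"
    then obtain n where "1 / Suc n < e"
      using nat_approx_posE by blast
    moreover obtain q where "q \<in> A" "x - 1 / Suc n < q"
      using * by blast
    ultimately show "x \<le> Sup A + e"
      using cSup_upper[OF _ bdd(2), of q] by linarith
  qed
  ultimately show "x \<in> interval_hull A"
    using \<open>A \<noteq> {}\<close> by (simp add: interval_hull_def)
qed


section \<open>The stake and the wealth\<close>

text \<open>For \<open>d > 0\<close> the truncation is active exactly when \<open>w * d / e\<close>
  exceeds 1, and dividing \<open>w\<close> by that number gives \<open>e / d\<close>. For
  \<open>d = 0\<close> the divisor is 1, so nothing is truncated.\<close>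

lemma min_divide_eq:
  fixes d e w :: real
  assumes "0 < e" "0 \<le> d"
  shows "(if d = 0 then w else min (e / d) w) = w / max 1 (w * d / e)"
  using assms by (auto simp: max_def min_def field_simps)

text \<open>Unlike the definition, this form has no singularity at the endpoints of the unit interval.\<close>

lemma clip_stake_eq:
  assumes "\<delta> < 1" "\<mu> \<in> {0..1}"
  shows "clip_stake \<delta> \<mu> z = z / max 1 (- z * (1 - \<mu>) / (1 - \<delta>)) / max 1 (z * \<mu> / (1 - \<delta>))"
proof -
  define w where "w = z / max 1 (- z * (1 - \<mu>) / (1 - \<delta>))"
  \<comment> \<open>The lower truncation of \<open>z\<close> is the upper truncation of
    \<open>- z\<close> with \<open>1 - \<mu>\<close> in place of \<open>\<mu>\<close>.\<close>
  have "(if 1 - \<mu> = 0 then - z else min ((1 - \<delta>) / (1 - \<mu>)) (- z)) = - w"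
    using min_divide_eq[of "1 - \<delta>" "1 - \<mu>" "- z"] assms by (simp add: w_def)
  then have lower: "(if \<mu> = 1 then z else max (- ((1 - \<delta>) / (1 - \<mu>))) z) = w"
    by (auto simp: min_def max_def split: if_splits)
  have upper: "(if \<mu> = 0 then w else min ((1 - \<delta>) / \<mu>) w) = w / max 1 (w * \<mu> / (1 - \<delta>))"
    using assms by (intro min_divide_eq) auto
  have "w = z" if "0 \<le> z"
  proof -
    have "- z * (1 - \<mu>) / (1 - \<delta>) \<le> 0"
      using that assms by (intro divide_nonpos_pos mult_nonpos_nonneg) auto
    then show ?thesis
      by (simp add: w_def max_def)
  qed
  moreover have "w * \<mu> / (1 - \<delta>) \<le> 0" "z * \<mu> / (1 - \<delta>) \<le> 0" if "z \<le> 0"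
  proof -
    have "w \<le> 0"
      unfolding w_def using that by (intro divide_nonpos_pos) auto
    then show "w * \<mu> / (1 - \<delta>) \<le> 0" "z * \<mu> / (1 - \<delta>) \<le> 0"
      using that assms by (auto intro!: divide_nonpos_pos mult_nonpos_nonneg)
  qed
  \<comment> \<open>The upper truncation sees \<open>w\<close> instead of \<open>z\<close>. For
    \<open>z \<ge> 0\<close> the two agree; for \<open>z \<le> 0\<close> both quotients are
    nonpositive and both maxima are 1.\<close>
  ultimately have "max 1 (w * \<mu> / (1 - \<delta>)) = max 1 (z * \<mu> / (1 - \<delta>))"
    by (cases "0 \<le> z") auto
  then show ?thesis
    unfolding clip_stake_def Let_def lower upper by (simp add: w_def)
qed

text \<open>Both truncations divide by a number that is at least 1. The bound therefore also holds
  at the endpoints of the unit interval, where one side is not truncated.\<close>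

lemma abs_clip_stake_le:
  assumes "\<delta> < 1" "\<mu> \<in> {0..1}"
  shows "\<bar>clip_stake \<delta> \<mu> z\<bar> \<le> \<bar>z\<bar>"
proof -
  have shrink: "\<bar>w / max 1 u\<bar> \<le> \<bar>w\<bar>" for w u :: real
    using divide_left_mono[of 1 "max 1 u" "\<bar>w\<bar>"] by (simp add: abs_divide)
  show ?thesis
    unfolding clip_stake_eq[OF assms] by (rule order_trans[OF shrink shrink])
qed

text \<open>The factor is affine in \<open>u\<close>, so it suffices to look at \<open>u = 0\<close>
  and \<open>u = 1\<close>, where the two clipping endpoints give the bounds.\<close>

lemma clip_stake_factor_nonneg:
  assumes "\<delta> \<in> {0..<1}" "\<mu> \<in> {0..1}" "u \<in> {0..1}"
  shows "0 \<le> 1 + clip_stake \<delta> \<mu> z * (u - \<mu>)"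
proof -
  define l where "l = clip_stake \<delta> \<mu> z"
  have lower: "- 1 \<le> l * (1 - \<mu>)"
  proof (cases "\<mu> = 1")
    case False
    \<comment> \<open>The upper truncation, applied last, cannot push the stake below the lower
      endpoint, because 0 separates the two endpoints.\<close>
    then have "- ((1 - \<delta>) / (1 - \<mu>)) \<le> l"
      using assms order_trans[of "- ((1 - \<delta>) / (1 - \<mu>))" 0 "(1 - \<delta>) / \<mu>"]
      by (auto simp: l_def clip_stake_def Let_def)
    then have "- (1 - \<delta>) \<le> l * (1 - \<mu>)"
      using False assms by (simp add: field_simps)
    then show ?thesis using assms by auto
  qed auto
  have upper: "l * \<mu> \<le> 1"
  proof (cases "\<mu> = 0")
    case False
    then have "l \<le> (1 - \<delta>) / \<mu>"
      by (simp add: l_def clip_stake_def Let_def)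
    then have "l * \<mu> \<le> 1 - \<delta>"
      using False assms by (simp add: field_simps)
    then show ?thesis using assms by auto
  qed auto
  have "1 + l * (u - \<mu>) = u * (1 + l * (1 - \<mu>)) + (1 - u) * (1 - l * \<mu>)"
    by (simp add: algebra_simps)
  moreover have "0 \<le> u * (1 + l * (1 - \<mu>))" "0 \<le> (1 - u) * (1 - l * \<mu>)"
    using assms lower upper by auto
  ultimately show ?thesis
    by (simp add: l_def)
qed

section \<open>Aggregated variance and a uniform bound on the stake\<close>

lemma sum_trust_weight:
  assumes "K \<ge> 1"
  shows "(\<Sum>k = 1..K. trust_weight \<eta> K m s y t k) = 1"
proof -
  have "(\<Sum>j = 1..K. exp (\<eta> * score m s y (t - 1) j)) > 0"
    using assms by (intro sum_pos) auto
  then show ?thesis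
    by (simp add: trust_weight_def flip: sum_divide_distrib)
qed

text \<open>The trust weights are nonnegative and sum to 1. The bound is uniform in \<open>y\<close>
  and \<open>t\<close>, as \<open>stake_bounded\<close> requires.\<close>

lemma agg_var_ge:
  assumes "K \<ge> 1" "\<And>k. k \<in> {1..K} \<Longrightarrow> c \<le> s k"
  shows "c \<le> agg_var \<eta> K m s y t"
proof -
  have "c = (\<Sum>k = 1..K. trust_weight \<eta> K m s y t k * c)"
    using sum_trust_weight[OF assms(1), of \<eta> m s y t] by (simp flip: sum_distrib_right)
  also have "\<dots> \<le> agg_var \<eta> K m s y t"
    unfolding agg_var_def using assms(2)
    by (intro sum_mono mult_left_mono) (auto simp: trust_weight_def intro!: divide_nonneg_nonneg sum_nonneg)
  finally show ?thesis .
qed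

lemma agg_var_pos:
  assumes "K \<ge> 1" "\<And>k. k \<in> {1..K} \<Longrightarrow> s k > 0"
  shows "agg_var \<eta> K m s y t > 0"
proof -
  have "Min (s ` {1..K}) > 0"
    using assms by (subst Min_gr_iff) auto
  then show ?thesis
    using agg_var_ge[OF assms(1), of "Min (s ` {1..K})" s] by (rule less_le_trans) auto
qed

text \<open>One constant serves all observation sequences and all rounds, since the denominator
  never falls below the smallest simulator variance. It supplies the bound \<open>C\<close> of
  \<open>ville_betting\<close>.\<close>

lemma stake_bounded:
  assumes "K \<ge> 1" "\<And>k. k \<in> {1..K} \<Longrightarrow> s k > 0" "\<kappa> \<in> {0..1}" "\<delta> < 1" "\<mu> \<in> {0..1}"
  obtains C where "\<And>y t. \<bar>stake \<eta> \<kappa> \<delta> K m s y t \<mu>\<bar> \<le> C"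
proof
  fix y t
  define c where "c = Min (s ` {1..K})"
  have c: "c > 0"
    unfolding c_def using assms by (subst Min_gr_iff) auto
  define v where "v = agg_var \<eta> K m s y t"
  have v: "c \<le> v"
    unfolding v_def by (rule agg_var_ge[OF assms(1)]) (simp add: c_def)
  define z where "z = agg_mean \<eta> K m s y t - \<mu>"
  have "\<bar>\<kappa> * z\<bar> \<le> 1 * \<bar>z\<bar>"
    unfolding abs_mult using assms by (intro mult_right_mono) auto
  \<comment> \<open>Even \<open>2 * \<bar>z\<bar> \<le> 1 + z\<^sup>2\<close> holds, by expanding
    the square of \<open>\<bar>z\<bar> - 1\<close>.\<close>
  also have "1 * \<bar>z\<bar> \<le> 1 + z\<^sup>2"
    using zero_le_power2[of "\<bar>z\<bar> - 1"] by (simp add: power2_diff)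
  \<comment> \<open>In the expanded right side, \<open>v / c\<close> pays for the 1 and
    \<open>z\<^sup>2\<close> for itself; the other terms are nonnegative.\<close>
  also have "1 + z\<^sup>2 \<le> (1 + 1 / c) * (v + z\<^sup>2)"
  proof -
    have "1 \<le> v / c" "0 \<le> z\<^sup>2 / c" "0 \<le> v"
      using c v by auto
    moreover have "(1 + 1 / c) * (v + z\<^sup>2) = v + z\<^sup>2 + v / c + z\<^sup>2 / c"
      by (simp add: algebra_simps add_divide_distrib)
    ultimately show ?thesis by linarith
  qed
  finally have "\<bar>\<kappa> * z / (v + z\<^sup>2)\<bar> \<le> 1 + 1 / c"
    using c v by (simp add: abs_divide divide_le_eq add_pos_nonneg abs_of_pos)
  then show "\<bar>stake \<eta> \<kappa> \<delta> K m s y t \<mu>\<bar> \<le> 1 + 1 / Min (s ` {1..K})"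
    using abs_clip_stake_le[OF assms(4,5), of "\<kappa> * z / (v + z\<^sup>2)"]
    unfolding stake_def v_def z_def c_def by linarith
qed

lemma wealth_nonneg:
  assumes "\<delta> \<in> {0..<1}" "\<mu> \<in> {0..1}" "\<And>i. i \<ge> 1 \<Longrightarrow> y i \<in> {0..1}"
  shows "0 \<le> wealth \<eta> \<kappa> \<delta> K m s y t \<mu>"
proof (induction t)
  case (Suc t)
  then show ?case
    using clip_stake_factor_nonneg[OF assms(1,2) assms(3)[of "Suc t"]] by (simp add: stake_def)
qed simp

section \<open>Continuity in the candidate mean\<close>

lemma continuous_on_stake:
  assumes "K \<ge> 1" "\<And>k. k \<in> {1..K} \<Longrightarrow> s k > 0" "\<delta> < 1"
  shows "continuous_on {0..1} (stake \<eta> \<kappa> \<delta> K m s y t)"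
proof -
  define z where "z \<mu> = \<kappa> * (agg_mean \<eta> K m s y t - \<mu>)
      / (agg_var \<eta> K m s y t + (agg_mean \<eta> K m s y t - \<mu>)\<^sup>2)" for \<mu>
  have "0 < agg_var \<eta> K m s y t + (agg_mean \<eta> K m s y t - \<mu>)\<^sup>2" for \<mu>
    by (intro add_pos_nonneg agg_var_pos assms(1,2) zero_le_power2)
  then have "agg_var \<eta> K m s y t + (agg_mean \<eta> K m s y t - \<mu>)\<^sup>2 \<noteq> 0" for \<mu>
    by (rule less_imp_neq[symmetric])
  then have "continuous_on {0..1} z"
    unfolding z_def by (intro continuous_intros) auto
  \<comment> \<open>By \<open>clip_stake_eq\<close> this is the stake. Both divisors are at least 1,
    so continuity extends to \<open>\<mu> = 0\<close> and \<open>\<mu> = 1\<close>.\<close>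
  then have "continuous_on {0..1}
      (\<lambda>\<mu>. z \<mu> / max 1 (- z \<mu> * (1 - \<mu>) / (1 - \<delta>)) / max 1 (z \<mu> * \<mu> / (1 - \<delta>)))"
    using assms(3) by (intro continuous_intros) (auto simp: max_def)
  then show ?thesis
    by (rule continuous_on_eq) (simp only: stake_def clip_stake_eq[OF assms(3)] z_def)
qed

lemma continuous_on_wealth:
  assumes "K \<ge> 1" "\<And>k. k \<in> {1..K} \<Longrightarrow> s k > 0" "\<delta> < 1"
  shows "continuous_on {0..1} (wealth \<eta> \<kappa> \<delta> K m s y t)"
proof (induction t)
  case (Suc t)
  then show ?case
    using continuous_on_stake[of K s \<delta>, OF assms] by (auto intro!: continuous_intros)
qed simp

section \<open>Measurability and dependence on the past\<close>

lemma score_measurable: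
  assumes "\<And>i. i \<in> {1..t} \<Longrightarrow> Y i \<in> borel_measurable M"
  shows "(\<lambda>\<omega>. score m s (\<lambda>i. Y i \<omega>) t k) \<in> borel_measurable M"
  using assms
proof (induction t)
  case (Suc t)
  have [measurable]: "(\<lambda>\<omega>. score m s (\<lambda>i. Y i \<omega>) t k) \<in> borel_measurable M"
    "Y (Suc t) \<in> borel_measurable M"
    using Suc by auto
  show ?case by simp
qed simp

text \<open>Stated for arbitrary measurable \<open>Y\<close> so that it serves twice: for the
  observations on the probability space, and for the coordinates of \<open>PiM {1..t}\<close>, the
  form that \<open>ville_betting\<close> asks for.\<close>

lemma stake_measurable:
  assumes "\<And>i. i \<in> {1..t} \<Longrightarrow> Y i \<in> borel_measurable M"
  shows "(\<lambda>\<omega>. stake \<eta> \<kappa> \<delta> K m s (\<lambda>i. Y i \<omega>) (Suc t) \<mu>) \<in> borel_measurable M"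
proof -
  note score_measurable[OF assms, measurable]
  show ?thesis
    unfolding stake_def clip_stake_def agg_mean_def agg_var_def trust_weight_def Let_def diff_Suc_1
    by measurable
qed

lemma wealth_measurable:
  assumes "\<And>i. i \<ge> 1 \<Longrightarrow> Y i \<in> borel_measurable M"
  shows "(\<lambda>\<omega>. wealth \<eta> \<kappa> \<delta> K m s (\<lambda>i. Y i \<omega>) t \<mu>) \<in> borel_measurable M"
proof (induction t)
  case (Suc t)
  note Suc [measurable]
  have [measurable]: "Y (Suc t) \<in> borel_measurable M"
    "(\<lambda>\<omega>. stake \<eta> \<kappa> \<delta> K m s (\<lambda>i. Y i \<omega>) (Suc t) \<mu>) \<in> borel_measurable M"
    using assms by (auto intro!: stake_measurable)
  show ?case by simp
qed simp

text \<open>Predictability: the stake of round \<open>Suc t\<close> reads the data only through the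
  scores after round \<open>t\<close>.\<close>

lemma stake_past:
  "stake \<eta> \<kappa> \<delta> K m s (restrict y {1..t}) (Suc t) \<mu> = stake \<eta> \<kappa> \<delta> K m s y (Suc t) \<mu>"
proof -
  have "score m s (restrict y {1..t}) r k = score m s y r k" if "r \<le> t" for r k
    using that by (induction r) auto
  then show ?thesis
    by (simp add: stake_def agg_mean_def agg_var_def trust_weight_def)
qed


section \<open>Coverage\<close>

text \<open>The uncovered candidates form a relatively closed set: \<open>A\<close> is a finite
  intersection of preimages of open half-lines under the continuous wealth. The condition
  \<open>t \<ge> 1\<close> makes the maximum in the certificate range over a nonempty set.\<close>

lemma certificate_iff_rational:
  fixes m s y :: "nat \<Rightarrow> real" and \<eta> \<kappa> \<delta> \<alpha> :: real
  assumes "K \<ge> 1" "\<And>k. k \<in> {1..K} \<Longrightarrow> s k > 0" "\<delta> < 1" "t \<ge> 1"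
  defines "A \<equiv> {\<mu> \<in> {0..1}. \<forall>r\<in>{1..t}. wealth \<eta> \<kappa> \<delta> K m s y r \<mu> < 1 / \<alpha>}"
  shows "\<mu> \<in> certificate \<eta> \<kappa> \<delta> \<alpha> K m s y t \<longleftrightarrow>
    (\<forall>n. \<exists>q\<in>\<rat>. q \<in> A \<and> q < \<mu> + 1 / Suc n) \<and> (\<forall>n. \<exists>q\<in>\<rat>. q \<in> A \<and> \<mu> - 1 / Suc n < q)"
proof -
  have "openin (top_of_set {0..1}) ({0..1} \<inter> wealth \<eta> \<kappa> \<delta> K m s y r -` {..<1 / \<alpha>})" for r
    using continuous_on_wealth[OF assms(1-3)] by (intro continuous_openin_preimage_gen) auto
  then have "openin (top_of_set {0..1})
      (\<Inter>r\<in>{1..t}. {0..1} \<inter> wealth \<eta> \<kappa> \<delta> K m s y r -` {..<1 / \<alpha>})"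
    using assms(4) by (intro openin_INT2) auto
  also have "(\<Inter>r\<in>{1..t}. {0..1} \<inter> wealth \<eta> \<kappa> \<delta> K m s y r -` {..<1 / \<alpha>}) = A"
    using assms(4) by (auto simp: A_def)
  finally obtain U where U: "open U" "A = {0..1} \<inter> U"
    unfolding openin_open by blast
  have "certificate \<eta> \<kappa> \<delta> \<alpha> K m s y t = interval_hull A"
    using assms(4) by (simp add: certificate_def A_def)
  then show ?thesis
    using interval_hull_rational_iff[OF U] by simp
qed

theorem proposition1:
  fixes \<Omega> :: "'w measure" and P :: "'x measure"
    and x :: "nat \<Rightarrow> 'w \<Rightarrow> 'x" and \<psi> :: "'x \<Rightarrow> real" and y :: "nat \<Rightarrow> 'w \<Rightarrow> real"
    and \<mu>star :: real
    and K T :: nat and m s :: "nat \<Rightarrow> real"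
    and \<eta> \<kappa> \<delta> \<alpha> :: real
  assumes "prob_space \<Omega>"
    and "prob_space P"
    and "\<psi> \<in> borel_measurable P"
    and "\<And>z. z \<in> space P \<Longrightarrow> \<psi> z \<in> {0..1}"
    and "prob_space.indep_vars \<Omega> (\<lambda>_. P) x {1..}"
    and "\<And>t. t \<ge> 1 \<Longrightarrow> distr \<Omega> P (x t) = P"
    and "\<And>t \<omega>. y t \<omega> = \<psi> (x t \<omega>)"
    and "\<And>t. t \<ge> 1 \<Longrightarrow> \<mu>star = prob_space.expectation \<Omega> (y t)"
    and "K \<ge> 1"
    and "\<And>k. k \<in> {1..K} \<Longrightarrow> m k \<in> {0..1}"
    and "\<And>k. k \<in> {1..K} \<Longrightarrow> s k > 0"
    and "\<eta> > 0"
    and "\<kappa> \<in> {0<..1}"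
    and "\<delta> \<in> {0<..<1}"
    and "\<alpha> \<in> {0<..<1}"
    and "T \<ge> 1"
  shows "prob_space.prob \<Omega> {\<omega> \<in> space \<Omega>.
           \<forall>t\<in>{1..T}. \<mu>star \<in> certificate \<eta> \<kappa> \<delta> \<alpha> K m s (\<lambda>i. y i \<omega>) t} \<ge> 1 - \<alpha>"
proof -
  interpret prob_space \<Omega> by fact
  let ?W = "\<lambda>t \<mu> \<omega>. wealth \<eta> \<kappa> \<delta> K m s (\<lambda>i. y i \<omega>) t \<mu>"
  define E where "E = {\<omega> \<in> space \<Omega>.
    \<forall>t\<in>{1..T}. \<mu>star \<in> certificate \<eta> \<kappa> \<delta> \<alpha> K m s (\<lambda>i. y i \<omega>) t}"
  define hit where "hit = {\<omega> \<in> space \<Omega>. \<exists>r\<le>T. 1 / \<alpha> \<le> ?W r \<mu>star \<omega>}"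

  have x_meas: "x t \<in> measurable \<Omega> P" if "t \<ge> 1" for t
    using assms(5) that by (auto simp: indep_vars_def)
  have indep: "indep_vars (\<lambda>_. borel) y {1..}"
    using indep_vars_compose2[OF assms(5), of "\<lambda>_. \<psi>" "\<lambda>_. borel"] assms(3)
    by (simp add: assms(7) [abs_def])
  then have y_meas: "y t \<in> borel_measurable \<Omega>" if "t \<ge> 1" for t
    using that by (auto simp: indep_vars_def)
  have y01: "y t \<omega> \<in> {0..1}" if "t \<ge> 1" "\<omega> \<in> space \<Omega>" for t \<omega>
    using assms(4) measurable_space[OF x_meas[OF that(1)] that(2)] by (simp add: assms(7))
  have "integrable \<Omega> (y 1)"
    using y01[of 1] y_meas[of 1] by (intro integrable_const_bound[where B = 1]) auto
  then have \<mu>star: "\<mu>star \<in> {0..1}"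
    using y01[of 1] assms(8)[of 1] by (auto intro!: integral_ge_const integral_le_const)
  have W_meas [measurable]: "?W t \<mu> \<in> borel_measurable \<Omega>" for t \<mu>
    using y_meas by (rule wealth_measurable)

  obtain C where C: "\<And>y t. \<bar>stake \<eta> \<kappa> \<delta> K m s y t \<mu>star\<bar> \<le> C"
    using stake_bounded[of K s \<kappa> \<delta> \<mu>star \<eta> m] assms \<mu>star by auto
  \<comment> \<open>Ville's inequality at level \<open>1 / \<alpha>\<close>, with the stake of round
    \<open>Suc t\<close> in the role of \<open>h t\<close>.\<close>
  have "prob hit \<le> 1 / (1 / \<alpha>)"
    unfolding hit_def
  proof (rule ville_betting[where Y = y and W = "\<lambda>t f. wealth \<eta> \<kappa> \<delta> K m s f t \<mu>star"
        and h = "\<lambda>t f. stake \<eta> \<kappa> \<delta> K m s f (Suc t) \<mu>star"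
        and C = C and \<mu> = \<mu>star])
    show "(\<lambda>f. stake \<eta> \<kappa> \<delta> K m s f (Suc t) \<mu>star) \<in> borel_measurable (PiM {1..t} (\<lambda>_. borel))" for t
      by (rule stake_measurable) (rule measurable_component_singleton)
    show "0 \<le> ?W t \<mu>star \<omega>" if "\<omega> \<in> space \<Omega>" for t \<omega>
      using assms(14) \<mu>star y01[OF _ that] by (intro wealth_nonneg) auto
  qed (use indep y01 assms(8,15) C in \<open>simp_all add: stake_past del: One_nat_def\<close>)
  then have hit: "prob hit \<le> \<alpha>" by simp
  have hit_event: "hit \<in> events"
    unfolding hit_def by measurable

  \<comment> \<open>All quantifiers now range over countable sets, and each atomic condition
    compares a measurable wealth with a constant.\<close>
  have "E = {\<omega> \<in> space \<Omega>. \<forall>t\<in>{1..T}.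
      (\<forall>n. \<exists>q\<in>\<rat>. (q \<in> {0..1} \<and> (\<forall>r\<in>{1..t}. ?W r q \<omega> < 1 / \<alpha>)) \<and> q < \<mu>star + 1 / Suc n) \<and>
      (\<forall>n. \<exists>q\<in>\<rat>. (q \<in> {0..1} \<and> (\<forall>r\<in>{1..t}. ?W r q \<omega> < 1 / \<alpha>)) \<and> \<mu>star - 1 / Suc n < q)}"
    unfolding E_def using certificate_iff_rational[OF assms(9,11)] assms(14) by simp
  also have "\<dots> \<in> events"
    using countable_rat by measurable
  finally have E_event: "E \<in> events" .

  \<comment> \<open>Off \<open>hit\<close> the true mean itself belongs to the set whose hull is
    taken, in every round. That set lies in \<open>{0..1}\<close>, so its infimum and supremum
    enclose the true mean.\<close>
  have "space \<Omega> - hit \<subseteq> E"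
  proof
    fix \<omega> assume \<omega>: "\<omega> \<in> space \<Omega> - hit"
    have "\<mu>star \<in> certificate \<eta> \<kappa> \<delta> \<alpha> K m s (\<lambda>i. y i \<omega>) t" if t: "t \<in> {1..T}" for t
    proof -
      define A where "A = {\<mu> \<in> {0..1}. (MAX r\<in>{1..t}. ?W r \<mu> \<omega>) < 1 / \<alpha>}"
      have "?W r \<mu>star \<omega> < 1 / \<alpha>" if "r \<le> T" for r
        using \<omega> that not_le unfolding hit_def by blast
      then have "\<mu>star \<in> A"
        using t \<mu>star by (auto simp: A_def)
      moreover have "bdd_below A" "bdd_above A"
        by (auto simp: A_def intro: bdd_belowI[of _ 0] bdd_aboveI[of _ 1])
      ultimately show ?thesis
        by (auto simp: certificate_def interval_hull_def A_def intro: cInf_lower cSup_upper)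
    qed
    with \<omega> show "\<omega> \<in> E"
      by (simp add: E_def)
  qed
  then have "prob (space \<Omega> - hit) \<le> prob E"
    using E_event by (rule finite_measure_mono)
  with hit show ?thesis
    unfolding E_def[symmetric] prob_compl[OF hit_event] by linarith
qed

end
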